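(* Let $(A,\rhd,\lhd)$ be a dialgebra. If there is a nondegenerate skew-symmetric invariant bilinear form $\mathfrak{B}$ on $A$ such that $(A,\rhd,\lhd,\mathfrak{B})$ is a skew-symmetric Frobenius dialgebra, then the two bimodules $$(A;L_{\rhd},R_{\rhd},L_{\lhd},R_{\lhd})\quad\text{and}\quad (A^*;\,-R_{\lhd}^*,\ L_{\lhd}^*-L_{\rhd}^*,\ R_{\rhd}^*-R_{\lhd}^*,\ -L_{\rhd}^* )$$ of the dialgebra $(A,\rhd,\lhd)$ are equivalent. Conversely, if these two bimodules are equivalent, then there exists a nondegenerate invariant bilinear form $\mathfrak{B}$ on $A$.
   Context: All vector spaces and algebras are finite-dimensional over a field $\mathbb F$ of characteristic $0$; algebras are not assumed unital. A dialgebra is a triple $(A,\rhd,\lhd)$ where $\rhd,\lhd$ are associative bilinear products on a vector space $A$ such that for all $x,y,z\in A$: $(x\lhd y)\lhd z=x\lhd(y\rhd z)$, $(x\rhd y)\lhd z=x\rhd(y\lhd z)$, $(x\lhd y)\rhd z=x\rhd(y\rhd z)$. A bilinear form $\mathfrak{B}$ on a dialgebra is invariant if $\mathfrak{B}(x\rhd y,z)=\mathfrak{B}(x,y\rhd z-y\lhd z)$ and $\mathfrak{B}(x\lhd y,z)=\mathfrak{B}(x,y\rhd z)$. A skew-symmetric Frobenius dialgebra is a dialgebra equipped with a nondegenerate skew-symmetric invariant bilinear form. A bimodule of an associative algebra $(A,\cdot)$ is $(V;l,r)$ with linear $l,r:A\to\mathrm{End}(V)$, $l(x\cdot y)=l(x)l(y)$,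 $r(x\cdot y)=r(y)r(x)$, $l(x)r(y)=r(y)l(x)$. A bimodule of a dialgebra $(A,\rhd,\lhd)$ is $(V;l_{\rhd},r_{\rhd},l_{\lhd},r_{\lhd})$ where $(V;l_{\rhd},r_{\rhd})$, $(V;l_{\lhd},r_{\lhd})$ are bimodules of $(A,\rhd)$, $(A,\lhd)$ respectively and $r_{\lhd}(x\lhd y)=r_{\lhd}(x\rhd y)$, $l_{\lhd}(x)r_{\lhd}(y)=l_{\lhd}(x)r_{\rhd}(y)$, $l_{\lhd}(x)l_{\lhd}(y)=l_{\lhd}(x)l_{\rhd}(y)$, $r_{\lhd}(x)r_{\rhd}(y)=r_{\rhd}(y\lhd x)$, $r_{\lhd}(x)l_{\rhd}(y)=l_{\rhd}(y)r_{\lhd}(x)$, $l_{\lhd}(x\rhd y)=l_{\rhd}(x)l_{\lhd}(y)$, $r_{\rhd}(x)r_{\lhd}(y)=r_{\rhd}(x)r_{\rhd}(y)$, $r_{\rhd}(x)l_{\lhd}(y)=r_{\rhd}(x)l_{\rhd}(y)$, $l_{\rhd}(x\lhd y)=l_{\rhd}(x\rhd y)$. Two bimodules $(V_i;l_{\rhd_i},r_{\rhd_i},l_{\lhd_i},r_{\lhd_i})$, $i=1,2$, of $(A,\rhd,\lhd)$ are equivalent if there is a linear isomorphism $\varphi:V_1\to V_2$ with $\varphi(l_{\rhd_1}(x)v)=l_{\rhd_2}(x)\varphi(v)$ and similarly for $r_{\rhd_i}$, $l_{\lhd_i}$, $r_{\lhd_i}$, for all $x\in A$, $v\in V_1$.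 Notation: $L_\diamond(x)y=x\diamond y=R_\diamond(y)x$; for linear $\varphi:A\to\mathrm{End}(V)$, $\varphi^*:A\to\mathrm{End}(V^* )$ is given by $\langle\varphi^*(x)v^*,u\rangle=-\langle v^*,\varphi(x)u\rangle$ (note the sign). Both quintuples in the claim are bimodules of $(A,\rhd,\lhd)$. *)

theory Defs
  imports Complex_Main "HOL-Library.Function_Algebras"
begin

definition fin_dim_subspace :: "('f::field \<Rightarrow> 'v::ab_group_add \<Rightarrow> 'v) \<Rightarrow> 'v set \<Rightarrow> bool" where
  "fin_dim_subspace scale V \<longleftrightarrow> (\<exists>S. finite S \<and> V = module.span scale S)"

text \<open>The algebra is the whole type \<^typ>\<open>'a\<close>, with scalar multiplication \<^term>\<open>scale\<close>.\<close>

locale assoc_algebra = vector_space scale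
  for scale :: "'f::field_char_0 \<Rightarrow> 'a::ab_group_add \<Rightarrow> 'a" +
  fixes mult :: "'a \<Rightarrow> 'a \<Rightarrow> 'a"
  assumes fin_dim: "fin_dim_subspace scale UNIV"
    and linear_right: "\<And>x. Vector_Spaces.linear scale scale (\<lambda>y. mult x y)"
    and linear_left: "\<And>y. Vector_Spaces.linear scale scale (\<lambda>x. mult x y)"
    and assoc: "\<And>x y z. mult (mult x y) z = mult x (mult y z)"

locale dialgebra = rhd: assoc_algebra scale rhd + lhd: assoc_algebra scale lhd
  for scale :: "'f::field_char_0 \<Rightarrow> 'a::ab_group_add \<Rightarrow> 'a"
    and rhd :: "'a \<Rightarrow> 'a \<Rightarrow> 'a"  (infixl \<open>\<rhd>\<close> 70)
    and lhd :: "'a \<Rightarrow> 'a \<Rightarrow> 'a"  (infixl \<open>\<lhd>\<close> 70) +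
  assumes lhd_lhd: "\<And>x y z. (x \<lhd> y) \<lhd> z = x \<lhd> (y \<rhd> z)"
    and rhd_lhd: "\<And>x y z. (x \<rhd> y) \<lhd> z = x \<rhd> (y \<lhd> z)"
    and lhd_rhd: "\<And>x y z. (x \<lhd> y) \<rhd> z = x \<rhd> (y \<rhd> z)"

definition bilinear_form ::
    "('f::field \<Rightarrow> 'a::ab_group_add \<Rightarrow> 'a) \<Rightarrow> ('a \<Rightarrow> 'a \<Rightarrow> 'f) \<Rightarrow> bool" where
  "bilinear_form scale B \<longleftrightarrow>
     (\<forall>x. Vector_Spaces.linear scale (*) (\<lambda>y. B x y)) \<and>
     (\<forall>y. Vector_Spaces.linear scale (*) (\<lambda>x. B x y))"

definition nondegenerate :: "('a::zero \<Rightarrow> 'a \<Rightarrow> 'f::zero) \<Rightarrow> bool" where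
  "nondegenerate B \<longleftrightarrow>
     (\<forall>x. (\<forall>y. B x y = 0) \<longrightarrow> x = 0) \<and> (\<forall>y. (\<forall>x. B x y = 0) \<longrightarrow> y = 0)"

definition skew_symmetric :: "('a \<Rightarrow> 'a \<Rightarrow> 'f::uminus) \<Rightarrow> bool" where
  "skew_symmetric B \<longleftrightarrow> (\<forall>x y. B x y = - B y x)"

definition invariant_form ::
    "('a::minus \<Rightarrow> 'a \<Rightarrow> 'a) \<Rightarrow> ('a \<Rightarrow> 'a \<Rightarrow> 'a) \<Rightarrow> ('a \<Rightarrow> 'a \<Rightarrow> 'f) \<Rightarrow> bool" where
  "invariant_form rhd lhd B \<longleftrightarrow>
     (\<forall>x y z. B (rhd x y) z = B x (rhd y z - lhd y z)) \<and>
     (\<forall>x y z. B (lhd x y) z = B x (rhd y z))"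

locale skew_frobenius_dialgebra = dialgebra scale rhd lhd
  for scale :: "'f::field_char_0 \<Rightarrow> 'a::ab_group_add \<Rightarrow> 'a"
    and rhd :: "'a \<Rightarrow> 'a \<Rightarrow> 'a"
    and lhd :: "'a \<Rightarrow> 'a \<Rightarrow> 'a" +
  fixes B :: "'a \<Rightarrow> 'a \<Rightarrow> 'f"
  assumes bilinear_form: "bilinear_form scale B"
    and nondegenerate: "nondegenerate B"
    and skew_symmetric: "skew_symmetric B"
    and invariant_form: "invariant_form rhd lhd B"

text \<open>
  The space of a bimodule is a finite-dimensional subspace \<^term>\<open>V\<close> of the type \<^typ>\<open>'v\<close>; this
  is needed for dual spaces, which are not types. Only the restrictions of \<^term>\<open>l x\<close> and
  \<^term>\<open>r x\<close> to \<^term>\<open>V\<close> are relevant, and these are elements of \<open>End(V)\<close>.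
\<close>

locale End_valued = A: vector_space sA + V: vector_space sV
  for sA :: "'f::field \<Rightarrow> 'a::ab_group_add \<Rightarrow> 'a"
    and sV :: "'f \<Rightarrow> 'v::ab_group_add \<Rightarrow> 'v" +
  fixes V :: "'v set" and f :: "'a \<Rightarrow> 'v \<Rightarrow> 'v"
  assumes closed: "\<And>x v. v \<in> V \<Longrightarrow> f x v \<in> V"
    and End_add: "\<And>x v w. v \<in> V \<Longrightarrow> w \<in> V \<Longrightarrow> f x (v + w) = f x v + f x w"
    and End_scale: "\<And>x c v. v \<in> V \<Longrightarrow> f x (sV c v) = sV c (f x v)"
    and add: "\<And>x y v. v \<in> V \<Longrightarrow> f (x + y) v = f x v + f y v"
    and scale: "\<And>c x v. v \<in> V \<Longrightarrow> f (sA c x) v = sV c (f x v)"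

locale assoc_bimodule =
  assoc_algebra sA mult + l: End_valued sA sV V l + r: End_valued sA sV V r
  for sA :: "'f::field_char_0 \<Rightarrow> 'a::ab_group_add \<Rightarrow> 'a"
    and mult :: "'a \<Rightarrow> 'a \<Rightarrow> 'a"
    and sV :: "'f \<Rightarrow> 'v::ab_group_add \<Rightarrow> 'v"
    and V :: "'v set"
    and l r :: "'a \<Rightarrow> 'v \<Rightarrow> 'v" +
  assumes fin_dim_space: "fin_dim_subspace sV V"
    and l_mult: "\<And>x y v. v \<in> V \<Longrightarrow> l (mult x y) v = l x (l y v)"
    and r_mult: "\<And>x y v. v \<in> V \<Longrightarrow> r (mult x y) v = r y (r x v)"
    and l_r: "\<And>x y v. v \<in> V \<Longrightarrow> l x (r y v) = r y (l x v)"

locale dialgebra_bimodule =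
  dialgebra sA rhd lhd +
  rhd_bimod: assoc_bimodule sA rhd sV V l_rhd r_rhd +
  lhd_bimod: assoc_bimodule sA lhd sV V l_lhd r_lhd
  for sA :: "'f::field_char_0 \<Rightarrow> 'a::ab_group_add \<Rightarrow> 'a"
    and rhd :: "'a \<Rightarrow> 'a \<Rightarrow> 'a"  (infixl \<open>\<rhd>\<close> 70)
    and lhd :: "'a \<Rightarrow> 'a \<Rightarrow> 'a"  (infixl \<open>\<lhd>\<close> 70)
    and sV :: "'f \<Rightarrow> 'v::ab_group_add \<Rightarrow> 'v"
    and V :: "'v set"
    and l_rhd r_rhd l_lhd r_lhd :: "'a \<Rightarrow> 'v \<Rightarrow> 'v" +
  assumes bimod1: "\<And>x y v. v \<in> V \<Longrightarrow> r_lhd (x \<lhd> y) v = r_lhd (x \<rhd> y) v"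
    and bimod2: "\<And>x y v. v \<in> V \<Longrightarrow> l_lhd x (r_lhd y v) = l_lhd x (r_rhd y v)"
    and bimod3: "\<And>x y v. v \<in> V \<Longrightarrow> l_lhd x (l_lhd y v) = l_lhd x (l_rhd y v)"
    and bimod4: "\<And>x y v. v \<in> V \<Longrightarrow> r_lhd x (r_rhd y v) = r_rhd (y \<lhd> x) v"
    and bimod5: "\<And>x y v. v \<in> V \<Longrightarrow> r_lhd x (l_rhd y v) = l_rhd y (r_lhd x v)"
    and bimod6: "\<And>x y v. v \<in> V \<Longrightarrow> l_lhd (x \<rhd> y) v = l_rhd x (l_lhd y v)"
    and bimod7: "\<And>x y v. v \<in> V \<Longrightarrow> r_rhd x (r_lhd y v) = r_rhd x (r_rhd y v)"
    and bimod8: "\<And>x y v. v \<in> V \<Longrightarrow> r_rhd x (l_lhd y v) = r_rhd x (l_rhd y v)"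
    and bimod9: "\<And>x y v. v \<in> V \<Longrightarrow> l_rhd (x \<lhd> y) v = l_rhd (x \<rhd> y) v"

definition equivalent_bimodules ::
    "('f::field_char_0 \<Rightarrow> 'a::ab_group_add \<Rightarrow> 'a) \<Rightarrow> ('a \<Rightarrow> 'a \<Rightarrow> 'a) \<Rightarrow> ('a \<Rightarrow> 'a \<Rightarrow> 'a) \<Rightarrow>
     ('f \<Rightarrow> 'v::ab_group_add \<Rightarrow> 'v) \<Rightarrow> 'v set \<Rightarrow>
     ('a \<Rightarrow> 'v \<Rightarrow> 'v) \<Rightarrow> ('a \<Rightarrow> 'v \<Rightarrow> 'v) \<Rightarrow> ('a \<Rightarrow> 'v \<Rightarrow> 'v) \<Rightarrow> ('a \<Rightarrow> 'v \<Rightarrow> 'v) \<Rightarrow>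
     ('f \<Rightarrow> 'w::ab_group_add \<Rightarrow> 'w) \<Rightarrow> 'w set \<Rightarrow>
     ('a \<Rightarrow> 'w \<Rightarrow> 'w) \<Rightarrow> ('a \<Rightarrow> 'w \<Rightarrow> 'w) \<Rightarrow> ('a \<Rightarrow> 'w \<Rightarrow> 'w) \<Rightarrow> ('a \<Rightarrow> 'w \<Rightarrow> 'w) \<Rightarrow> bool" where
  "equivalent_bimodules sA rhd lhd
       sV V l_rhd1 r_rhd1 l_lhd1 r_lhd1
       sW W l_rhd2 r_rhd2 l_lhd2 r_lhd2 \<longleftrightarrow>
     dialgebra_bimodule sA rhd lhd sV V l_rhd1 r_rhd1 l_lhd1 r_lhd1 \<and>
     dialgebra_bimodule sA rhd lhd sW W l_rhd2 r_rhd2 l_lhd2 r_lhd2 \<and>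
     (\<exists>\<phi>. bij_betw \<phi> V W \<and>
        (\<forall>v\<in>V. \<forall>w\<in>V. \<phi> (v + w) = \<phi> v + \<phi> w) \<and>
        (\<forall>c. \<forall>v\<in>V. \<phi> (sV c v) = sW c (\<phi> v)) \<and>
        (\<forall>x. \<forall>v\<in>V. \<phi> (l_rhd1 x v) = l_rhd2 x (\<phi> v)) \<and>
        (\<forall>x. \<forall>v\<in>V. \<phi> (r_rhd1 x v) = r_rhd2 x (\<phi> v)) \<and>
        (\<forall>x. \<forall>v\<in>V. \<phi> (l_lhd1 x v) = l_lhd2 x (\<phi> v)) \<and>
        (\<forall>x. \<forall>v\<in>V. \<phi> (r_lhd1 x v) = r_lhd2 x (\<phi> v)))"

definition L :: "('a \<Rightarrow> 'a \<Rightarrow> 'a) \<Rightarrow> 'a \<Rightarrow> 'a \<Rightarrow> 'a" where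
  "L mult x y = mult x y"

definition R :: "('a \<Rightarrow> 'a \<Rightarrow> 'a) \<Rightarrow> 'a \<Rightarrow> 'a \<Rightarrow> 'a" where
  "R mult y x = mult x y"

definition dual_space :: "('f::field \<Rightarrow> 'v::ab_group_add \<Rightarrow> 'v) \<Rightarrow> ('v \<Rightarrow> 'f) set" where
  "dual_space scale = {g. Vector_Spaces.linear scale (*) g}"

definition dual_scale :: "'f::times \<Rightarrow> ('v \<Rightarrow> 'f) \<Rightarrow> 'v \<Rightarrow> 'f" where
  "dual_scale c g = (\<lambda>u. c * g u)"

text \<open>
  The minus sign belongs to the definition. Sums, differences and negatives of maps
  \<^typ>\<open>'a \<Rightarrow> ('v \<Rightarrow> 'f) \<Rightarrow> 'v \<Rightarrow> 'f\<close> are the pointwise ones, so \<open>dual \<phi> - dual \<psi>\<close> and \<open>- dual \<phi>\<close>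
  restrict on the dual space to the corresponding combinations in \<open>End(V\<^sup>*)\<close>.
\<close>

definition dual :: "('a \<Rightarrow> 'v \<Rightarrow> 'v) \<Rightarrow> 'a \<Rightarrow> ('v \<Rightarrow> 'f::uminus) \<Rightarrow> 'v \<Rightarrow> 'f" where
  "dual \<phi> x g = (\<lambda>u. - g (\<phi> x u))"

text \<open>
  The regular quintuple on a dialgebra and its dual counterpart are always bimodules
  (\<open>regular_bimodule\<close> and \<open>dual_bimodule\<close> below), so for these two quintuples the bimodule
  conditions in \<^const>\<open>equivalent_bimodules\<close> hold automatically.
\<close>

lemma linearD:
  assumes "Vector_Spaces.linear s1 s2 g"
  shows "g (x + y) = g x + g y" "g (x - y) = g x - g y" "g (s1 c x) = s2 c (g x)"
    "g (- x) = - g x" "g 0 = 0"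
proof -
  interpret Vector_Spaces.linear s1 s2 g by fact
  show "g (x + y) = g x + g y" "g (x - y) = g x - g y" "g (s1 c x) = s2 c (g x)"
    "g (- x) = - g x" "g 0 = 0"
    by (simp_all add: add diff scale neg)
qed

lemma linearI:
  assumes "vector_space s1" "vector_space s2" "\<And>x y. g (x + y) = g x + g y"
    "\<And>c x. g (s1 c x) = s2 c (g x)"
  shows "Vector_Spaces.linear s1 s2 g"
  using assms unfolding Vector_Spaces.linear_def module_hom_def module_hom_axioms_def
  by (simp add: vector_space_def module_def)

lemma vector_space_field: "vector_space ((*) :: 'f::field \<Rightarrow> 'f \<Rightarrow> 'f)"
  by unfold_locales (auto simp: algebra_simps)

lemma vector_space_dual_scale:
  "vector_space (dual_scale :: 'f::field \<Rightarrow> ('v \<Rightarrow> 'f) \<Rightarrow> 'v \<Rightarrow> 'f)"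
  by unfold_locales (auto simp: dual_scale_def fun_eq_iff algebra_simps)

context dialgebra
begin

lemmas mult_linear =
  linearD[OF rhd.linear_left] linearD[OF rhd.linear_right]
  linearD[OF lhd.linear_left] linearD[OF lhd.linear_right]

lemma lhd_lhd': "x \<lhd> (y \<rhd> z) = x \<lhd> (y \<lhd> z)"
  using lhd.assoc lhd_lhd by metis

lemma regular_bimodule:
  "dialgebra_bimodule scale (\<rhd>) (\<lhd>) scale UNIV (L (\<rhd>)) (R (\<rhd>)) (L (\<lhd>)) (R (\<lhd>))"
  by unfold_locales
    (simp_all only: L_def R_def mult_linear UNIV_I rhd.fin_dim rhd.assoc lhd.assoc lhd_lhd' rhd_lhd lhd_rhd)

lemma dual_iff: "g \<in> dual_space scale \<longleftrightarrow>
   (\<forall>x y. g (x + y) = g x + g y) \<and> (\<forall>x y. g (x - y) = g x - g y) \<and>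
   (\<forall>c x. g (scale c x) = c * g x) \<and> (\<forall>x. g (- x) = - g x) \<and> g 0 = 0" (is "_ \<longleftrightarrow> ?r")
proof
  assume "g \<in> dual_space scale"
  then have g: "Vector_Spaces.linear scale (*) g" by (simp add: dual_space_def)
  show ?r using linearD[OF g] by blast
next
  assume ?r
  then show "g \<in> dual_space scale"
    unfolding dual_space_def using linearI[OF rhd.vector_space_axioms vector_space_field, of g] by blast
qed

lemma dualI: "(\<And>x y. g (x + y) = g x + g y) \<Longrightarrow> (\<And>c x. g (scale c x) = c * g x) \<Longrightarrow> g \<in> dual_space scale"
  unfolding dual_space_def using linearI[OF rhd.vector_space_axioms vector_space_field, of g] by blast

lemma sum_fun_apply: "(\<Sum>a\<in>T. f a) u = (\<Sum>a\<in>T. f a u)"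
  by (induction T rule: infinite_finite_induct) auto

lemma fin_dim_dual_space: "fin_dim_subspace dual_scale (dual_space scale)"
proof -
  interpret D: vector_space "dual_scale :: 'f \<Rightarrow> ('a \<Rightarrow> 'f) \<Rightarrow> _" by (rule vector_space_dual_scale)
  obtain S where S: "finite S" "rhd.span S = UNIV"
    using rhd.fin_dim unfolding fin_dim_subspace_def by metis
  obtain E where E: "E \<subseteq> S" "rhd.independent E" "rhd.span E = UNIV"
    using rhd.maximal_independent_subset[of S] S by (metis rhd.span_mono rhd.span_span top.extremum_uniqueI)
  have fE: "finite E" using E S finite_subset by blast
  let ?c = "\<lambda>e u. rhd.representation E u e"
  have lin: "?c e \<in> dual_space scale" for e
    using E by (intro dualI) (auto simp: rhd.representation_add rhd.representation_scale)
  have sub: "D.subspace (dual_space scale)"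
    unfolding D.subspace_def
    by (auto simp: dual_iff dual_scale_def distrib_left right_diff_distrib)
  have "g \<in> D.span (?c ` E)" if "g \<in> dual_space scale" for g
  proof -
    interpret g: Vector_Spaces.linear scale "(*)" g using that by (simp add: dual_space_def)
    have "g u = (\<Sum>e\<in>E. g e * ?c e u)" for u
    proof -
      have "u = (\<Sum>e\<in>E. scale (?c e u) e)"
        using rhd.sum_representation_eq[of E u E] E fE by simp
      then have "g u = g (\<Sum>e\<in>E. scale (?c e u) e)" by simp
      also have "\<dots> = (\<Sum>e\<in>E. g e * ?c e u)"
        by (simp add: g.sum g.scale mult.commute)
      finally show ?thesis .
    qed
    then have "g = (\<Sum>e\<in>E. dual_scale (g e) (?c e))"
      unfolding fun_eq_iff sum_fun_apply dual_scale_def by blast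
    also have "\<dots> \<in> D.span (?c ` E)"
      by (intro D.span_sum D.span_scale D.span_base) auto
    finally show ?thesis .
  qed
  moreover have "D.span (?c ` E) \<subseteq> dual_space scale"
    by (rule D.span_minimal) (use lin sub in auto)
  ultimately show ?thesis
    unfolding fin_dim_subspace_def using fE by blast
qed

lemma dual_bimodule:
  "dialgebra_bimodule scale (\<rhd>) (\<lhd>) dual_scale (dual_space scale)
     (- dual (R (\<lhd>))) (dual (L (\<lhd>)) - dual (L (\<rhd>)))
     (dual (R (\<rhd>)) - dual (R (\<lhd>))) (- dual (L (\<rhd>)))"
proof -
  interpret D: vector_space "dual_scale :: 'f \<Rightarrow> ('a \<Rightarrow> 'f) \<Rightarrow> _" by (rule vector_space_dual_scale)
  note simps = L_def R_def dual_def dual_scale_def fun_eq_iff mult_linear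
    rhd.assoc lhd.assoc lhd_lhd' rhd_lhd lhd_rhd distrib_left right_diff_distrib
  show ?thesis
    apply (unfold_locales;
        ((rule fin_dim_dual_space; fail) |
          (rule dualI)?; (simp only: dual_iff)?; (elim conjE)?;
          (simp (no_asm_simp) add: simps algebra_simps; fail)?))
    done
qed
end

end

(* A bilinear form B is the same thing as the linear map x |-> B x _ into the dual space. In finite
   dimension it is bijective iff B is nondegenerate, and invariance of B says precisely that it
   intertwines the right actions. For the left actions the two arguments of B have to be exchanged,
   which is where skew-symmetry enters. *)

theory Submission
  imports Defs
begin

lemma sum_apply: "(\<Sum>a\<in>T. f a) u = (\<Sum>a\<in>T. f a u)"
  by (induction T rule: infinite_finite_induct) auto

context vector_space
begin

lemma fin_dim_subspace_UNIV_basis: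
  assumes "fin_dim_subspace scale UNIV"
  obtains E where "finite E" "independent E" "span E = UNIV"
proof -
  obtain S where S: "finite S" "span S = UNIV"
    using assms unfolding fin_dim_subspace_def by metis
  obtain E where "E \<subseteq> S" "independent E" "S \<subseteq> span E"
    using maximal_independent_subset[of S] by metis
  with S show ?thesis
    using that finite_subset span_mono span_span by (metis top.extremum_uniqueI)
qed

text \<open>The function sends \<open>u\<close> to its coordinate at \<open>e\<close>. As
  \<open>e\<close> ranges over the basis \<open>E\<close>, these functions form the basis dual to
  \<open>E\<close>.\<close>

lemma representation_in_dual_space:
  assumes "independent E" "span E = UNIV"
  shows "(\<lambda>u. representation E u e) \<in> dual_space scale"
  unfolding dual_space_def mem_Collect_eq
  by (rule linearI[OF vector_space_axioms vector_space_field])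
    (use assms in \<open>auto simp: representation_add representation_scale\<close>)

text \<open>Functionals separate points: the coordinates of \<open>u\<close> in a basis are values
  of functionals, so all of them vanish. For a form whose curried map is onto the dual space, this
  yields nondegeneracy in the second argument.\<close>

lemma dual_space_eq_0:
  assumes "fin_dim_subspace scale UNIV" and "\<And>g. g \<in> dual_space scale \<Longrightarrow> g u = 0"
  shows "u = 0"
proof -
  obtain E where E: "finite E" "independent E" "span E = UNIV"
    using assms(1) by (rule fin_dim_subspace_UNIV_basis)
  have "(\<Sum>e\<in>E. scale (representation E u e) e) = u"
    using sum_representation_eq[of E u E] E by simp
  then show ?thesis
    using assms(2)[OF representation_in_dual_space[OF E(2,3)]] by simp
qed

text \<open>A functional \<open>g\<close> has coefficients \<open>g e\<close> in the dual basis.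
  This bounds the dimension of the dual space by \<open>card E\<close>.\<close>

lemma dual_space_subset_span:
  assumes "finite E" "independent E" "span E = UNIV"
  shows "dual_space scale
    \<subseteq> module.span dual_scale ((\<lambda>e u. representation E u e) ` E)"
proof
  interpret D: vector_space "dual_scale :: 'a \<Rightarrow> ('b \<Rightarrow> 'a) \<Rightarrow> _"
    by (rule vector_space_dual_scale)
  fix g assume "g \<in> dual_space scale"
  then interpret g: Vector_Spaces.linear scale "(*)" g
    by (simp add: dual_space_def)
  have "g u = (\<Sum>e\<in>E. g e * representation E u e)" for u
  proof -
    have "g u = g (\<Sum>e\<in>E. scale (representation E u e) e)"
      using sum_representation_eq[of E u E] assms by simp
    then show ?thesis
      by (simp add: g.sum g.scale mult.commute)
  qed
  then have "g = (\<Sum>e\<in>E. dual_scale (g e) (\<lambda>u. representation E u e))"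
    unfolding fun_eq_iff sum_apply dual_scale_def by blast
  also have "\<dots> \<in> D.span ((\<lambda>e u. representation E u e) ` E)"
    by (intro D.span_sum D.span_scale D.span_base) auto
  finally show "g \<in> D.span ((\<lambda>e u. representation E u e) ` E)" .
qed

text \<open>The assumption \<open>left\<close> says that the curried map \<open>B\<close> has
  trivial kernel; surjectivity then comes from comparing dimensions.\<close>

lemma left_nondegenerate_bij_betw_dual_space:
  assumes fin_dim: "fin_dim_subspace scale UNIV"
    and bilin: "bilinear_form scale B"
    and left: "\<And>x. (\<And>y. B x y = 0) \<Longrightarrow> x = 0"
  shows "bij_betw B UNIV (dual_space scale)"
proof -
  interpret D: vector_space "dual_scale :: 'a \<Rightarrow> ('b \<Rightarrow> 'a) \<Rightarrow> _"
    by (rule vector_space_dual_scale)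
  have B_left: "Vector_Spaces.linear scale (*) (\<lambda>x. B x y)" for y
    using bilin by (simp add: bilinear_form_def)
  interpret B: Vector_Spaces.linear scale dual_scale B
    by (rule linearI[OF vector_space_axioms vector_space_dual_scale])
      (auto simp: fun_eq_iff dual_scale_def linearD[OF B_left])
  have inj: "inj B"
    unfolding B.inj_iff_eq_0 using left by (auto simp: fun_eq_iff)
  obtain E where E: "finite E" "independent E" "span E = UNIV"
    using fin_dim by (rule fin_dim_subspace_UNIV_basis)
  define C where "C = (\<lambda>e u. representation E u e) ` E"
  have C: "finite C" "card C \<le> card E" "dual_space scale \<subseteq> D.span C"
    using E dual_space_subset_span card_image_le by (auto simp: C_def)
  have range: "range B \<subseteq> dual_space scale"
    using bilin by (auto simp: bilinear_form_def dual_space_def)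
  have "g \<in> range B" if "g \<in> dual_space scale" for g
  proof (rule ccontr)
    assume "g \<notin> range B"
    then have notin: "g \<notin> D.span (B ` E)"
      using E B.span_image by simp
    have "D.independent (B ` E)"
      using E inj by (intro B.independent_injective_image) (auto intro: inj_on_subset)
    then have "D.independent (insert g (B ` E))"
      using notin by (simp add: D.independent_insertI)
    moreover have "insert g (B ` E) \<subseteq> D.span C"
      using that range C by auto
    ultimately have "card (insert g (B ` E)) \<le> card C"
      using C D.independent_span_bound by blast
    moreover have "card (insert g (B ` E)) = Suc (card E)"
      using E notin inj D.span_base
      by (subst card_insert_disjoint) (auto simp: card_image inj_on_subset)
    ultimately show False using C by simp
  qed
  then show ?thesis using inj range by (auto simp: bij_betw_def)
qed

end

context dialgebra
begin

lemma skew_frobenius_imp_equivalent: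
  assumes "skew_frobenius_dialgebra scale (\<rhd>) (\<lhd>) B"
  shows "equivalent_bimodules scale (\<rhd>) (\<lhd>)
    scale UNIV (L (\<rhd>)) (R (\<rhd>)) (L (\<lhd>)) (R (\<lhd>))
    dual_scale (dual_space scale)
    (- dual (R (\<lhd>))) (dual (L (\<lhd>)) - dual (L (\<rhd>)))
    (dual (R (\<rhd>)) - dual (R (\<lhd>))) (- dual (L (\<rhd>)))"
proof -
  interpret skew_frobenius_dialgebra scale "(\<rhd>)" "(\<lhd>)" B by fact
  have linL: "Vector_Spaces.linear scale (*) (\<lambda>x. B x y)"
    and linR: "Vector_Spaces.linear scale (*) (B x)" for x y
    using bilinear_form by (simp_all add: bilinear_form_def)
  note lin = linearD[OF linL] linearD[OF linR]
  have skew: "B x y = - B y x" for x y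
    using skew_symmetric unfolding skew_symmetric_def by blast
  have rhd_inv: "B (x \<rhd> y) z = B x (y \<rhd> z) - B x (y \<lhd> z)"
    and lhd_inv: "B (x \<lhd> y) z = B x (y \<rhd> z)" for x y z
    using invariant_form by (simp_all add: invariant_form_def lin)
  \<comment> \<open>Skew-symmetry on both sides of \<open>lhd_inv\<close> read backwards: \<open>B
    (x \<rhd> v) u = - B u (x \<rhd> v) = - B (u \<lhd> x) v = B v (u \<lhd> x)\<close>.\<close>
  have L_rhd: "B (x \<rhd> v) u = B v (u \<lhd> x)" for x v u
    by (metis skew lhd_inv)
  have L_lhd: "B (x \<lhd> v) u = B v (u \<lhd> x) - B v (u \<rhd> x)" for x v u
  proof -
    \<comment> \<open>The term \<open>B u (x \<rhd> v)\<close> is inserted and subtracted again: the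
      first two terms are then the right side of \<open>rhd_inv\<close>, and the last one is that of
      \<open>lhd_inv\<close>.\<close>
    have "B (x \<lhd> v) u = B u (x \<rhd> v) - B u (x \<lhd> v) - B u (x \<rhd> v)"
      using skew[of "x \<lhd> v" u] by simp
    also have "\<dots> = B (u \<rhd> x) v - B (u \<lhd> x) v"
      by (simp only: rhd_inv lhd_inv)
    also have "\<dots> = B v (u \<lhd> x) - B v (u \<rhd> x)"
      using skew[of v "u \<lhd> x"] skew[of v "u \<rhd> x"] by simp
    finally show ?thesis .
  qed
  have "bij_betw B UNIV (dual_space scale)"
    using rhd.left_nondegenerate_bij_betw_dual_space[OF rhd.fin_dim bilinear_form] nondegenerate
    by (auto simp: nondegenerate_def)
  moreover have "B (v + w) = B v + B w" "B (scale c v) = dual_scale c (B v)" for v w c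
    by (simp_all add: fun_eq_iff dual_scale_def lin)
  \<comment> \<open>The outer minus cancels the sign built into \<open>dual\<close>:
    \<open>(- dual (R (\<lhd>))) x g\<close> sends \<open>u\<close> to
    \<open>g (u \<lhd> x)\<close>. The other three actions unfold in the same way.\<close>
  moreover have "B (L (\<rhd>) x v) = (- dual (R (\<lhd>))) x (B v)" for x v
    by (simp add: fun_eq_iff L_def R_def dual_def L_rhd)
  moreover have "B (R (\<rhd>) x v) = (dual (L (\<lhd>)) - dual (L (\<rhd>))) x (B v)" for x v
    by (simp add: fun_eq_iff L_def R_def dual_def rhd_inv)
  moreover have "B (L (\<lhd>) x v) = (dual (R (\<rhd>)) - dual (R (\<lhd>))) x (B v)" for x v
    by (simp add: fun_eq_iff L_def R_def dual_def L_lhd)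
  moreover have "B (R (\<lhd>) x v) = (- dual (L (\<rhd>))) x (B v)" for x v
    by (simp add: fun_eq_iff L_def R_def dual_def lhd_inv)
  ultimately show ?thesis
    unfolding equivalent_bimodules_def
    by (intro conjI regular_bimodule dual_bimodule exI[of _ B]) simp_all
qed

text \<open>The equivalence itself serves as the form: its values are functionals, so it is already
  a curried function of two arguments.\<close>

lemma equivalent_imp_invariant_form:
  assumes "equivalent_bimodules scale (\<rhd>) (\<lhd>)
    scale UNIV (L (\<rhd>)) (R (\<rhd>)) (L (\<lhd>)) (R (\<lhd>))
    dual_scale (dual_space scale)
    (- dual (R (\<lhd>))) (dual (L (\<lhd>)) - dual (L (\<rhd>)))
    (dual (R (\<rhd>)) - dual (R (\<lhd>))) (- dual (L (\<rhd>)))"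
  shows "\<exists>B. bilinear_form scale B \<and> nondegenerate B \<and> invariant_form (\<rhd>) (\<lhd>) B"
proof -
  obtain B where bij: "bij_betw B UNIV (dual_space scale)"
    and add: "\<And>v w. B (v + w) = B v + B w"
    and scl: "\<And>c v. B (scale c v) = dual_scale c (B v)"
    and R_rhd: "\<And>x v. B (R (\<rhd>) x v) = (dual (L (\<lhd>)) - dual (L (\<rhd>))) x (B v)"
    and R_lhd: "\<And>x v. B (R (\<lhd>) x v) = (- dual (L (\<rhd>))) x (B v)"
    using assms unfolding equivalent_bimodules_def by auto
  \<comment> \<open>Linearity in the second argument holds because the values lie in the dual space;
    in the first it is linearity of the equivalence.\<close>
  have linR: "Vector_Spaces.linear scale (*) (B x)" for x
    using bij by (auto simp: bij_betw_def dual_space_def)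
  have linL: "Vector_Spaces.linear scale (*) (\<lambda>x. B x y)" for y
    by (rule linearI[OF rhd.vector_space_axioms vector_space_field])
      (simp_all add: add scl dual_scale_def)
  \<comment> \<open>Nondegeneracy in the first argument comes from injectivity.\<close>
  have "x = 0" if "\<And>y. B x y = 0" for x
  proof -
    have "B x = B 0"
      using that linearD(5)[OF linL] by (simp add: fun_eq_iff)
    then show ?thesis
      using bij by (auto simp: bij_betw_def dest: injD)
  qed
  \<comment> \<open>Nondegeneracy in the second argument comes from surjectivity: every functional
    is some \<open>B x\<close>, so all of them vanish at \<open>y\<close>.\<close>
  moreover have "y = 0" if "\<And>x. B x y = 0" for y
  proof (rule rhd.dual_space_eq_0[OF rhd.fin_dim])
    fix g assume "g \<in> dual_space scale"
    then obtain x where "g = B x"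
      using bij by (metis bij_betw_imp_surj_on rangeE)
    then show "g y = 0" using that by simp
  qed
  \<comment> \<open>Since \<open>R (\<rhd>) y x\<close> is \<open>x \<rhd> y\<close>, intertwining
    for the right action of \<open>y\<close>, evaluated at \<open>z\<close>, is the invariance
    identity.\<close>
  moreover have "B (x \<rhd> y) z = B x (y \<rhd> z - y \<lhd> z)" for x y z
    using fun_cong[OF R_rhd[of y x], of z]
    by (simp add: L_def R_def dual_def linearD[OF linR])
  moreover have "B (x \<lhd> y) z = B x (y \<rhd> z)" for x y z
    using fun_cong[OF R_lhd[of y x], of z] by (simp add: L_def R_def dual_def)
  ultimately show ?thesis
    using linL linR
    by (intro exI[of _ B]) (auto simp: bilinear_form_def nondegenerate_def invariant_form_def)
qed

end

theorem proposition2p26: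
  fixes scale :: "'f::field_char_0 \<Rightarrow> 'a::ab_group_add \<Rightarrow> 'a"
    and rhd lhd :: "'a \<Rightarrow> 'a \<Rightarrow> 'a"
  assumes "dialgebra scale rhd lhd"
  shows "((\<exists>B. skew_frobenius_dialgebra scale rhd lhd B) \<longrightarrow>
          equivalent_bimodules scale rhd lhd
            scale UNIV (L rhd) (R rhd) (L lhd) (R lhd)
            dual_scale (dual_space scale)
              (- dual (R lhd)) (dual (L lhd) - dual (L rhd))
              (dual (R rhd) - dual (R lhd)) (- dual (L rhd))) \<and>
         (equivalent_bimodules scale rhd lhd
            scale UNIV (L rhd) (R rhd) (L lhd) (R lhd)
            dual_scale (dual_space scale)
              (- dual (R lhd)) (dual (L lhd) - dual (L rhd))
              (dual (R rhd) - dual (R lhd)) (- dual (L rhd)) \<longrightarrow>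
          (\<exists>B. bilinear_form scale B \<and> nondegenerate B \<and> invariant_form rhd lhd B))"
  using dialgebra.skew_frobenius_imp_equivalent[OF assms]
    dialgebra.equivalent_imp_invariant_form[OF assms]
  by blast

end
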